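(* Let $a>0$, $D=(-a/2,a/2)^2$, let $S\in L^2(\mathbb{R}^2)$ have compact support contained in $D$, let $N\in\mathbb{N}_+$ and $k\in\mathbb{K}_N$. Let $u_\infty=u_\infty(\cdot,k)$ be the far-field pattern of $S$ at wavenumber $k$, assumed not identically zero. Let $0<\epsilon<1$, and let $p^\epsilon$ (the noisy measurement of $|u_\infty|$) and $q_1^\epsilon,q_2^\epsilon$ (the noisy measurements of the moduli of the far fields with added reference sources) be nonnegative functions in $L^\infty(\Omega)$ satisfying $$\big\|p^\epsilon-|u_\infty|\big\|_\infty\le\epsilon\|u_\infty\|_\infty,\qquad \big\|q_j^\epsilon-|\hat v_{j,\infty}|\big\|_\infty\le\epsilon\|\hat v_{j,\infty}\|_\infty,\quad j=1,2,$$ where $$c_j^\epsilon=\frac{\|p^\epsilon\|_\infty}{|\gamma|},\qquad \hat v_{j,\infty}(\hat x)=u_\infty(\hat x)-c_j^\epsilon\,\gamma\,\mathrm{e}^{-\mathrm{i}k\hat x\cdot z_j},\quad z_j=\alpha_j\hat x,\quad \hat x\in\Omega.$$ Let the recovered far field $u_\infty^\epsilon:\Omega\to\mathbb{C}$ be defined, for each $\hat x\in\Omega$, as the solution $u_\infty^\epsilon(\hat x)=\Re u_\infty^\epsilon(\hat x)+\mathrm{i}\,\Im u_\infty^\epsilon(\hat x)$ of the real $2\times2$ linear system $$(-\Im\gamma\sin t_{k,j}-\Re\gamma\cos t_{k,j})\,\Re u_\infty^\epsilon(\hat x)+(\Re\gamma\sin t_{k,j}-\Im\gamma\cos t_{k,j})\,\Im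 u_\infty^\epsilon(\hat x)=f_j^\epsilon(\hat x),\quad j=1,2,$$ where $t_{k,j}=k\,\hat x\cdot z_j$ and $$f_j^\epsilon(\hat x)=\frac{1}{2c_j^\epsilon}\Big(q_j^\epsilon(\hat x)^2-p^\epsilon(\hat x)^2-(c_j^\epsilon)^2|\gamma|^2\Big).$$ Then $$\|u_\infty^\epsilon-u_\infty\|_\infty\le C_\epsilon\|u_\infty\|_\infty,\qquad C_\epsilon=2\epsilon\,\frac{(\epsilon+3)(\epsilon+2)^2+6}{1-\epsilon}.$$
   Context: The setting is two-dimensional. $\Omega$ is the unit circle in $\mathbb{R}^2$ and $\|\cdot\|_\infty=\|\cdot\|_{L^\infty(\Omega)}$. $\Re$ and $\Im$ denote real and imaginary parts. Wavenumbers: $k^*=\frac{\pi}{9a}$ and $\mathbb{K}_N=\left\{\frac{2\pi}{a}|\boldsymbol{l}|:\boldsymbol{l}\in\mathbb{Z}^2,\ 1\le|\boldsymbol{l}|_\infty\le N\right\}\cup\{k^*\}$, where $|\boldsymbol{l}|$ is the Euclidean norm and $|\boldsymbol{l}|_\infty$ the maximum norm. Constants: $\gamma=\frac{\mathrm{e}^{\mathrm{i}\pi/4}}{\sqrt{8\pi k}}$. Far-field pattern of the source $S$ (i.e. of the radiating solution of $\Delta u+k^2u=S$ in $\mathbb{R}^2$): $u_\infty(\hat x,k)=-\gamma\int_D S(y)\,\mathrm{e}^{-\mathrm{i}k\hat x\cdot y}\,\mathrm{d}y$, $\hat x\in\Omega$. Reference source parameters: $\alpha_1=\frac12$; $\alpha_2=\frac12-\frac{\pi}{2k}$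 if $k\in\mathbb{K}_N\setminus\{k^*\}$, and $\alpha_2=-4$ if $k=k^*$. The reference points $z_j=\alpha_j\hat x$ depend on the observation direction $\hat x$; $\gamma\,\mathrm{e}^{-\mathrm{i}k\hat x\cdot z_j}$ is the far-field pattern in direction $\hat x$ of the fundamental solution of the Helmholtz equation with source at $z_j$.
   Formalization: For k = k* it is additionally assumed that |sin(k(α_1−α_2))| = |sin(π/(2a))| ≥ 5/14 (true for a = 1); without a bound of this kind the 2×2 system can be singular (e.g. a = 1/2) and the estimate fails. Nothing is added for k ≠ k*. *)

theory Defs
  imports "HOL-Probability.Essential_Supremum"
begin

section \<open>Function spaces\<close>

abbreviation unit_circle :: "(real ^ 2) set" where
  "unit_circle \<equiv> sphere 0 1"

text \<open>
  Arc-length measure on the unit circle, completed: the functions below may be measurable with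
  respect to the completion, not only Borel measurable.
\<close>
definition circle_measure :: "(real ^ 2) measure" where
  "circle_measure = completion
     (distr (restrict_space lborel {0..<2 * pi}) (restrict_space borel unit_circle)
        (\<lambda>\<theta>. vector [cos \<theta>, sin \<theta>]))"

text \<open>
  The norm takes values in the extended reals, and is infinite for functions that are not
  measurable, so that a bound by a finite number carries membership in the space.
\<close>
definition Linf_norm :: "'a measure \<Rightarrow> ('a \<Rightarrow> 'b :: real_normed_vector) \<Rightarrow> ereal" where
  "Linf_norm M f =
     (if f \<in> borel_measurable M then esssup M (\<lambda>x. ereal (norm (f x))) else \<infinity>)"

definition Linf :: "'a measure \<Rightarrow> ('a \<Rightarrow> 'b :: real_normed_vector) set" where
  "Linf M = {f \<in> borel_measurable M. Linf_norm M f < \<infinity>}"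

definition L2 :: "'a measure \<Rightarrow> ('a \<Rightarrow> 'b :: real_normed_vector) set" where
  "L2 M = {f \<in> borel_measurable M. integrable M (\<lambda>x. (norm (f x))\<^sup>2)}"

definition ess_support :: "('a :: euclidean_space \<Rightarrow> 'b :: zero) \<Rightarrow> 'a set" where
  "ess_support f = - \<Union>{U. open U \<and> (AE x in lebesgue. x \<in> U \<longrightarrow> f x = 0)}"


section \<open>Wavenumbers and the far-field pattern\<close>

definition square :: "real \<Rightarrow> (real ^ 2) set" where
  "square a = {x. \<forall>i. - a / 2 < x $ i \<and> x $ i < a / 2}"

definition kstar :: "real \<Rightarrow> real" where
  "kstar a = pi / (9 * a)"

definition wavenumbers :: "real \<Rightarrow> nat \<Rightarrow> real set" where
  "wavenumbers a N =
     {2 * pi / a * sqrt ((of_int l1)\<^sup>2 + (of_int l2)\<^sup>2) | l1 l2 :: int.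
        1 \<le> max \<bar>l1\<bar> \<bar>l2\<bar> \<and> max \<bar>l1\<bar> \<bar>l2\<bar> \<le> int N} \<union> {kstar a}"

definition gam :: "real \<Rightarrow> complex" where
  "gam k = exp (\<i> * of_real pi / 4) / of_real (sqrt (8 * pi * k))"

definition far_field :: "real \<Rightarrow> (real ^ 2 \<Rightarrow> complex) \<Rightarrow> real \<Rightarrow> real ^ 2 \<Rightarrow> complex" where
  "far_field a S k x =
     - gam k * set_lebesgue_integral lebesgue (square a)
                 (\<lambda>y. S y * exp (- \<i> * of_real k * of_real (x \<bullet> y)))"


section \<open>Reference sources and phase retrieval\<close>

text \<open>The index \<open>j\<close> ranges over 1 and 2.\<close>
definition ref_alpha :: "real \<Rightarrow> real \<Rightarrow> nat \<Rightarrow> real" where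
  "ref_alpha a k j =
     (if j = 1 then 1 / 2 else if k = kstar a then - 4 else 1 / 2 - pi / (2 * k))"

definition ref_point :: "real \<Rightarrow> real \<Rightarrow> nat \<Rightarrow> real ^ 2 \<Rightarrow> real ^ 2" where
  "ref_point a k j x = ref_alpha a k j *\<^sub>R x"

text \<open>The scaling factor of the reference sources is the same for \<open>j = 1\<close> and \<open>j = 2\<close>.\<close>
definition ref_scale :: "real \<Rightarrow> (real ^ 2 \<Rightarrow> real) \<Rightarrow> real" where
  "ref_scale k p = real_of_ereal (Linf_norm circle_measure p) / cmod (gam k)"

definition ref_far_field ::
  "real \<Rightarrow> (real ^ 2 \<Rightarrow> complex) \<Rightarrow> real \<Rightarrow> (real ^ 2 \<Rightarrow> real) \<Rightarrow> nat \<Rightarrow> real ^ 2 \<Rightarrow> complex" where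
  "ref_far_field a S k p j x =
     far_field a S k x
       - of_real (ref_scale k p) * gam k
           * exp (- \<i> * of_real k * of_real (x \<bullet> ref_point a k j x))"

definition ref_phase :: "real \<Rightarrow> real \<Rightarrow> nat \<Rightarrow> real ^ 2 \<Rightarrow> real" where
  "ref_phase a k j x = k * (x \<bullet> ref_point a k j x)"

definition retrieval_rhs ::
  "real \<Rightarrow> (real ^ 2 \<Rightarrow> real) \<Rightarrow> (real ^ 2 \<Rightarrow> real) \<Rightarrow> real ^ 2 \<Rightarrow> real" where
  "retrieval_rhs k p qj x =
     1 / (2 * ref_scale k p)
       * ((qj x)\<^sup>2 - (p x)\<^sup>2 - (ref_scale k p)\<^sup>2 * (cmod (gam k))\<^sup>2)"

definition solves_retrieval_system ::
  "real \<Rightarrow> real \<Rightarrow> (real ^ 2 \<Rightarrow> real) \<Rightarrow> (nat \<Rightarrow> real ^ 2 \<Rightarrow> real) \<Rightarrow> real ^ 2 \<Rightarrow> complex \<Rightarrow> bool"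
  where
  "solves_retrieval_system a k p q x w \<longleftrightarrow>
     (\<forall>j\<in>{1, 2}.
        (- Im (gam k) * sin (ref_phase a k j x) - Re (gam k) * cos (ref_phase a k j x)) * Re w
        + (Re (gam k) * sin (ref_phase a k j x) - Im (gam k) * cos (ref_phase a k j x)) * Im w
        = retrieval_rhs k p (q j) x)"

definition stability_const :: "real \<Rightarrow> real" where
  "stability_const \<epsilon> = 2 * \<epsilon> * (((\<epsilon> + 3) * (\<epsilon> + 2)\<^sup>2 + 6) / (1 - \<epsilon>))"

text \<open>
  The determinant of the retrieval system is
  \<open>(cmod (gam k))\<^sup>2 * sin (k * (ref_alpha a k 1 - ref_alpha a k 2))\<close>. The sine is 1 for every
  wavenumber other than \<open>kstar a\<close>, but at \<open>kstar a\<close> it is \<open>sin (pi / (2 * a))\<close>, because the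
  value \<open>-4\<close> is not scaled with \<open>a\<close>: it is 1 if \<open>a = 1\<close>, and for other \<open>a\<close> it can vanish or be
  arbitrarily small, in which case the stability estimate fails. The condition below concerns
  only \<open>kstar a\<close>. With \<open>s\<close> the absolute value of the sine, solving the system bounds the error by
  \<open>\<epsilon> * (\<epsilon> + 2) * ((\<epsilon> + 2)\<^sup>2 + 1) / ((1 - \<epsilon>) * s)\<close> times the norm of the far field, and
  5/14 is the least \<open>s\<close> for which this is at most \<open>stability_const \<epsilon>\<close> for all \<open>\<epsilon>\<close> in (0, 1).
\<close>
definition kstar_nondegenerate :: "real \<Rightarrow> real \<Rightarrow> bool" where
  "kstar_nondegenerate a k \<longleftrightarrow>
     (k = kstar a \<longrightarrow> 5 / 14 \<le> \<bar>sin (k * (ref_alpha a k 1 - ref_alpha a k 2))\<bar>)"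

end

theory Submission
  imports Defs
begin

text \<open>
  At each direction the law of cosines expresses the squared modulus of the superposition of the far
  field and a reference field through the squared moduli of the two fields and a cross term, which
  is linear in the far field. Two reference sources give two linear equations. They prescribe the
  projections of one and the same complex number, the far field times the conjugate of \<open>gam k\<close>,
  onto two lines whose angle is the difference of the reference phases, so the error of
  this product is at most the sum of the errors of the projections divided by the absolute value of
  the sine of that angle (\<open>cmod_le_two_projections\<close>). The sine is at least 5/14
  (\<open>phase_difference_sin_ge\<close>).

  Let \<open>M\<close> be the norm of the far field. The measured norm lies between \<open>(1 - \<epsilon>) * M\<close> and
  \<open>(1 + \<epsilon>) * M\<close>, and the reference fields have modulus equal to it. Hence the superpositions have
  norm at most \<open>(\<epsilon> + 2) * M\<close>. An error \<open>d\<close> in a modulus at most \<open>b\<close> becomes an error at most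
  \<open>d * (d + 2 * b)\<close> in its square: this gives \<open>\<epsilon> * (\<epsilon> + 2) ^ 3 * M\<^sup>2\<close> for the superpositions and
  \<open>\<epsilon> * (\<epsilon> + 2) * M\<^sup>2\<close> for the far field. Division by twice the strength \<open>ref_scale k p\<close>
  of the reference sources turns the sum into an error of order
  \<open>\<epsilon> * M / (1 - \<epsilon>) * cmod (gam k)\<close> in each projection (\<open>retrieval_row_error\<close>), and an elementary
  inequality absorbs the sine into the constant (\<open>stability_const_bound\<close>).

  The hypotheses bound essential suprema, so these estimates hold almost everywhere. To return to
  norms, the fields must be measurable and \<open>M\<close> must be a positive real number. For the far field
  both follow from its continuity (\<open>continuous_on_far_field\<close>,
  \<open>Linf_norm_circle_continuous_pos\<close>); the recovered field is measurable because the matrix of the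
  system does not depend on the direction (\<open>solves_retrieval_system_measurable\<close>).
\<close>

section \<open>The essential supremum norm on the circle\<close>

lemma Linf_norm_le_iff:
  assumes "f \<in> borel_measurable M"
  shows "Linf_norm M f \<le> ereal B \<longleftrightarrow> (AE x in M. norm (f x) \<le> B)"
proof
  assume "Linf_norm M f \<le> ereal B"
  then have "esssup M (\<lambda>x. ereal (norm (f x))) \<le> ereal B"
    using assms by (simp add: Linf_norm_def)
  then show "AE x in M. norm (f x) \<le> B"
    using esssup_AE[of "\<lambda>x. ereal (norm (f x))" M]
    by (auto elim!: eventually_mono dest: order_trans)
next
  assume "AE x in M. norm (f x) \<le> B"
  then show "Linf_norm M f \<le> ereal B"
    using assms by (auto simp: Linf_norm_def intro!: esssup_I)
qed

lemma continuous_on_circle_param: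
  "continuous_on UNIV (\<lambda>\<theta>. vector [cos \<theta>, sin \<theta>] :: real ^ 2)"
proof -
  have "(vector [cos \<theta>, sin \<theta>] :: real ^ 2) = (\<chi> i. if i = 1 then cos \<theta> else sin \<theta>)" for \<theta>
    by (simp add: vec_eq_iff forall_2)
  moreover have "continuous_on UNIV (\<lambda>\<theta>. (\<chi> i. if i = 1 then cos \<theta> else sin \<theta>) :: real ^ 2)"
  proof (rule continuous_on_vec_lambda)
    show "continuous_on UNIV (\<lambda>\<theta>. if i = 1 then cos \<theta> else sin \<theta> :: real)" for i :: 2
      by (cases "i = 1") (auto intro!: continuous_intros)
  qed
  ultimately show ?thesis by simp
qed

lemma circle_param_measurable:
  "(\<lambda>\<theta>. vector [cos \<theta>, sin \<theta>] :: real ^ 2)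
     \<in> restrict_space lborel {0..<2 * pi} \<rightarrow>\<^sub>M restrict_space borel unit_circle"
proof -
  have "continuous_on UNIV (\<lambda>\<theta>. vector [cos \<theta>, sin \<theta>] :: real ^ 2)"
    by (rule continuous_on_circle_param)
  then have "(\<lambda>\<theta>. vector [cos \<theta>, sin \<theta>] :: real ^ 2) \<in> borel_measurable borel"
    by (rule borel_measurable_continuous_onI)
  then show ?thesis
    by (intro measurable_restrict_space2 measurable_restrict_space1)
      (auto simp: norm_vec_def L2_set_def sum_2)
qed

lemma space_circle_measure [simp]: "space circle_measure = unit_circle"
  by (simp add: circle_measure_def space_restrict_space)

lemma continuous_imp_measurable_circle:
  fixes f :: "real ^ 2 \<Rightarrow> 'b :: {metric_space, real_normed_vector}"
  assumes "continuous_on UNIV f"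
  shows "f \<in> borel_measurable circle_measure"
  unfolding circle_measure_def
  using borel_measurable_continuous_onI[OF assms]
  by (intro measurable_completion) (simp add: measurable_restrict_space1)

text \<open>
  Arc-length measure charges every nonempty open arc. Since the angle runs over a half-open
  interval, the arc is taken to the right of the angle of the given point: there it is never cut off
  by the endpoint, even at angle 0.
\<close>
lemma continuous_AE_circle_zero:
  fixes f :: "real ^ 2 \<Rightarrow> 'b :: real_normed_vector"
  assumes cont: "continuous_on UNIV f" and ae: "AE x in circle_measure. f x = 0"
    and x: "x \<in> unit_circle"
  shows "f x = 0"
proof (rule ccontr)
  assume nz: "f x \<noteq> 0"
  define c where "c \<theta> = (vector [cos \<theta>, sin \<theta>] :: real ^ 2)" for \<theta>
  have "(x $ 1)\<^sup>2 + (x $ 2)\<^sup>2 = 1"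
    using x by (simp add: norm_vec_def L2_set_def sum_2)
  then obtain \<theta> where \<theta>: "0 \<le> \<theta>" "\<theta> < 2 * pi" "x $ 1 = cos \<theta>" "x $ 2 = sin \<theta>"
    using sincos_total_2pi by metis
  then have xc: "x = c \<theta>"
    by (simp add: c_def vec_eq_iff forall_2)
  have "continuous_on UNIV (\<lambda>t. f (c t))"
    unfolding c_def
    by (rule continuous_on_compose2[OF cont continuous_on_circle_param]) auto
  then have "isCont (\<lambda>t. f (c t)) \<theta>"
    by (simp add: continuous_on_eq_continuous_at)
  then obtain \<delta> where \<delta>: "\<delta> > 0" "\<And>t. dist \<theta> t < \<delta> \<Longrightarrow> f (c t) \<noteq> 0"
    using continuous_at_avoid[of \<theta> "\<lambda>t. f (c t)" 0] nz xc by auto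
  define \<eta> where "\<eta> = min \<delta> (2 * pi - \<theta>)"
  have \<eta>: "\<eta> > 0" using \<delta> \<theta> by (simp add: \<eta>_def)
  have meas: "{x \<in> space (restrict_space borel unit_circle). f x = 0}
      \<in> sets (restrict_space borel unit_circle)"
    using measurable_restrict_space1[OF borel_measurable_continuous_onI[OF cont]]
    by measurable
  have "AE t in restrict_space lborel {0..<2 * pi}. f (c t) = 0"
    using ae unfolding circle_measure_def AE_completion_iff c_def
    by (rule AE_distr_iff[OF circle_param_measurable meas, THEN iffD1])
  then have "AE t in lborel. t \<in> {0..<2 * pi} \<longrightarrow> f (c t) = 0"
    by (subst (asm) AE_restrict_space_iff) auto
  then have "AE t in lborel. t \<notin> {\<theta>..<\<theta> + \<eta>}"
    by (rule eventually_mono) (use \<delta> \<theta> in \<open>force simp: \<eta>_def dist_real_def\<close>)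
  then have "emeasure lborel {\<theta>..<\<theta> + \<eta>} = 0"
    by (simp add: AE_iff_null null_setsD1 del: atLeastLessThan_iff)
  with \<eta> show False by simp
qed

text \<open>
  An essential supremum over a null space is \<open>- \<infinity>\<close>, so nonnegativity expresses that the circle has
  positive length. This is what allows the norms to be treated as real numbers.
\<close>
lemma Linf_norm_circle_nonneg: "0 \<le> Linf_norm circle_measure f"
proof (rule ccontr)
  assume neg: "\<not> 0 \<le> Linf_norm circle_measure f"
  then have m: "f \<in> borel_measurable circle_measure"
    by (auto simp: Linf_norm_def split: if_splits)
  have "AE x in circle_measure. ereal (norm (f x)) \<le> Linf_norm circle_measure f"
    using m esssup_AE by (simp add: Linf_norm_def)
  then have "AE x in circle_measure. (1::real) = 0"
  proof (rule eventually_mono)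
    fix x assume "ereal (norm (f x)) \<le> Linf_norm circle_measure f"
    also have "Linf_norm circle_measure f < 0" using neg by simp
    finally show "(1::real) = 0" by simp
  qed
  from continuous_AE_circle_zero[OF _ this, of "axis 1 1"] show False by simp
qed

lemma Linf_norm_circle_continuous_pos:
  fixes f :: "real ^ 2 \<Rightarrow> 'b :: {metric_space, real_normed_vector}"
  assumes cont: "continuous_on UNIV f" and "x \<in> unit_circle" "f x \<noteq> 0"
  obtains M where "M > 0" "Linf_norm circle_measure f = ereal M"
proof -
  have meas: "f \<in> borel_measurable circle_measure"
    using cont by (rule continuous_imp_measurable_circle)
  have "bounded (f ` unit_circle)"
    using cont by (intro compact_imp_bounded compact_continuous_image)
      (auto intro: continuous_on_subset)
  then obtain B where "\<And>x. x \<in> unit_circle \<Longrightarrow> norm (f x) \<le> B"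
    unfolding bounded_iff by blast
  then have "Linf_norm circle_measure f \<le> ereal B"
    by (subst Linf_norm_le_iff[OF meas]) (auto intro!: AE_I2)
  with Linf_norm_circle_nonneg[of f] obtain M where
    M: "Linf_norm circle_measure f = ereal M" "0 \<le> M"
    by (cases "Linf_norm circle_measure f") auto
  have "M \<noteq> 0"
  proof
    assume "M = 0"
    then have "AE x in circle_measure. f x = 0"
      using Linf_norm_le_iff[OF meas, of 0] M by simp
    from continuous_AE_circle_zero[OF cont this] assms show False by blast
  qed
  with M that show thesis by simp
qed

section \<open>Continuity of the far-field pattern\<close>

text \<open>
  The square is bounded, so a square-integrable source is integrable on it: \<open>\<bar>S\<bar> \<le> 1 + \<bar>S\<bar>\<^sup>2\<close>. The
  far field is then the Fourier transform of an integrable function, and dominated convergence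
  applies. Continuity yields at once that the far field is measurable for the completed arc-length
  measure, is bounded on the circle, and has positive norm unless it is zero everywhere.
\<close>
lemma continuous_on_far_field:
  assumes S: "S \<in> L2 lebesgue"
  shows "continuous_on UNIV (far_field a S k)"
proof -
  have sq: "square a = box (\<chi> i. - a / 2) (\<chi> i. a / 2)"
    by (auto simp: square_def mem_box_cart)
  have [measurable]: "square a \<in> sets lebesgue" "S \<in> borel_measurable lebesgue"
    using S by (auto simp: sq L2_def)
  have one: "integrable lebesgue (indicator (square a) :: real ^ 2 \<Rightarrow> real)"
    using lmeasurable_box[of "(\<chi> i. - a / 2) :: real ^ 2" "\<chi> i. a / 2"]
    by (simp add: sq fmeasurable_def)
  have S1: "integrable lebesgue (\<lambda>y. indicator (square a) y * norm (S y))"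
  proof (rule Bochner_Integration.integrable_bound)
    show "integrable lebesgue (\<lambda>y. indicator (square a) y + (norm (S y))\<^sup>2)"
      using one S by (auto simp: L2_def)
    show "AE y in lebesgue. norm (indicator (square a) y * norm (S y))
        \<le> norm (indicator (square a) y + (norm (S y))\<^sup>2)"
    proof (rule AE_I2)
      fix y
      have "norm (S y) \<le> 1 + (norm (S y))\<^sup>2"
        using sum_squares_bound[of "norm (S y)" 1] norm_ge_zero[of "S y"]
        by (simp del: norm_ge_zero)
      then show "norm (indicator (square a) y * norm (S y))
          \<le> norm (indicator (square a) y + (norm (S y))\<^sup>2)"
        by (simp add: indicator_def)
    qed
  qed measurable
  have exp_meas: "(\<lambda>y :: real ^ 2. exp (- \<i> * of_real k * of_real (x \<bullet> y)))
      \<in> borel_measurable lebesgue" for x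
  proof -
    have "continuous_on UNIV (\<lambda>y :: real ^ 2. exp (- \<i> * of_real k * of_real (x \<bullet> y)))"
      by (intro continuous_intros)
    then show ?thesis
      by (intro measurable_completion) (simp add: borel_measurable_continuous_onI)
  qed
  show ?thesis
    unfolding far_field_def
  proof (intro continuous_intros continuous_on_sequentiallyI)
    fix x :: "nat \<Rightarrow> real ^ 2" and l assume x: "x \<longlonglongrightarrow> l"
    show "(\<lambda>n. set_lebesgue_integral lebesgue (square a)
              (\<lambda>y. S y * exp (- \<i> * of_real k * of_real (x n \<bullet> y))))
        \<longlonglongrightarrow> set_lebesgue_integral lebesgue (square a)
              (\<lambda>y. S y * exp (- \<i> * of_real k * of_real (l \<bullet> y)))"
      unfolding set_lebesgue_integral_def
    proof (rule integral_dominated_convergence[OF _ _ S1])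
      show "AE y in lebesgue. (\<lambda>n. indicator (square a) y *\<^sub>R
             (S y * exp (- \<i> * of_real k * of_real (x n \<bullet> y))))
          \<longlonglongrightarrow> indicator (square a) y *\<^sub>R (S y * exp (- \<i> * of_real k * of_real (l \<bullet> y)))"
        by (rule AE_I2) (intro tendsto_intros x)
      show "AE y in lebesgue. norm (indicator (square a) y *\<^sub>R
             (S y * exp (- \<i> * of_real k * of_real (x n \<bullet> y))))
          \<le> indicator (square a) y * norm (S y)" for n
        by (rule AE_I2) (simp add: norm_mult)
    qed (use exp_meas in measurable)
  qed
qed

section \<open>Algebra of the retrieval system\<close>

text \<open>
  The unknown enters the system only through \<open>w * cnj g\<close>: each equation prescribes the real part
  of this number after a rotation by the phase of one reference source.
\<close>
lemma retrieval_row_eq: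
  "(- Im g * sin t - Re g * cos t) * Re w + (Re g * sin t - Im g * cos t) * Im w
     = - Re (w * cnj g * cis t)"
  by (simp add: algebra_simps)

text \<open>
  The law of cosines is the origin of the retrieval system: divided by \<open>2 * c\<close>, the cross term is the
  left-hand side, so with exact moduli the true far field is a solution.
\<close>
lemma cmod_minus_reference_square:
  "(cmod (u - of_real c * g * cis (- t)))\<^sup>2
     = (cmod u)\<^sup>2 + c\<^sup>2 * (cmod g)\<^sup>2 - 2 * c * Re (u * cnj g * cis t)"
proof -
  have "c\<^sup>2 * (cmod g)\<^sup>2 = (cmod (of_real c * g * cis (- t)))\<^sup>2"
    by (simp add: norm_mult power_mult_distrib)
  then show ?thesis
    unfolding cmod_power2 by (simp add: algebra_simps power2_eq_square)
qed

text \<open>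
  Cramer's rule in complex form. Writing each real part as half the sum of a number and its
  conjugate, the multiplications by \<open>cis s\<close> and \<open>cis t\<close> turn both conjugate terms into
  \<open>cnj z\<close>, and these cancel in the difference.
\<close>
lemma two_projections_eq:
  "\<i> * z * cis s * cis t * of_real (sin (s - t))
     = of_real (Re (z * cis s)) * cis s - of_real (Re (z * cis t)) * cis t"
proof -
  have unit: "cis s * cnj (cis s) = 1" "cis t * cnj (cis t) = 1"
    by (simp_all add: cis_cnj cis_mult)
  have "2 * \<i> * of_real (sin (s - t)) = cis s * cnj (cis t) - cis t * cnj (cis s)"
    by (simp add: complex_eq_iff sin_diff)
  moreover have "2 * complex_of_real (Re x) = x + cnj x" for x
    by (simp add: complex_eq_iff)
  ultimately have sin: "\<i> * of_real (sin (s - t)) = (cis s * cnj (cis t) - cis t * cnj (cis s)) / 2"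
    and Re: "complex_of_real (Re x) = (x + cnj x) / 2" for x
    by (simp_all add: field_simps)
  have "\<i> * z * cis s * cis t * of_real (sin (s - t))
      = z * cis s * cis t * (\<i> * of_real (sin (s - t)))"
    by simp
  also have "\<dots> = of_real (Re (z * cis s)) * cis s - of_real (Re (z * cis t)) * cis t"
    unfolding sin Re complex_cnj_mult using unit by algebra
  finally show ?thesis .
qed

lemma cmod_le_two_projections:
  "cmod z * \<bar>sin (s - t)\<bar> \<le> \<bar>Re (z * cis s)\<bar> + \<bar>Re (z * cis t)\<bar>"
proof -
  have "cmod z * \<bar>sin (s - t)\<bar> = cmod (\<i> * z * cis s * cis t * of_real (sin (s - t)))"
    by (simp add: norm_mult)
  also have "\<dots> \<le> \<bar>Re (z * cis s)\<bar> + \<bar>Re (z * cis t)\<bar>"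
    unfolding two_projections_eq by (rule order_trans[OF norm_triangle_ineq4])
      (simp only: norm_mult norm_of_real norm_cis mult_1_right order_refl)
  finally show ?thesis .
qed

section \<open>Propagation of the noise\<close>

lemma abs_diff_squares_le:
  fixes x y :: real
  assumes "\<bar>x - y\<bar> \<le> d" "\<bar>y\<bar> \<le> b"
  shows "\<bar>x\<^sup>2 - y\<^sup>2\<bar> \<le> d * (d + 2 * b)"
proof -
  have "\<bar>x\<^sup>2 - y\<^sup>2\<bar> = \<bar>x - y\<bar> * \<bar>x + y\<bar>"
    by (simp add: abs_mult[symmetric] power2_eq_square algebra_simps)
  also have "\<dots> \<le> d * (d + 2 * b)"
    using assms by (intro mult_mono) auto
  finally show ?thesis .
qed

text \<open>
  Subtracting the law of cosines for \<open>u\<close> from the equation for \<open>w\<close> leaves only the errors of the two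
  squared moduli, divided by \<open>2 * c\<close>. These errors are of size \<open>\<epsilon> * M\<^sup>2\<close>, whereas the
  reference field, being scaled to the measured norm, has modulus \<open>c * cmod g\<close> of size \<open>M\<close>; so the
  quotient is of size \<open>\<epsilon> * M * cmod g\<close>.
\<close>
lemma retrieval_row_error:
  assumes M: "M > 0" and \<epsilon>: "0 < \<epsilon>" "\<epsilon> < 1" and g: "g \<noteq> 0"
    and c: "(1 - \<epsilon>) * M \<le> c * cmod g"
    and u: "cmod u \<le> M" and p: "\<bar>p - cmod u\<bar> \<le> \<epsilon> * M"
    and v: "cmod (u - of_real c * g * cis (- t)) \<le> (\<epsilon> + 2) * M"
    and q: "\<bar>q - cmod (u - of_real c * g * cis (- t))\<bar> \<le> \<epsilon> * ((\<epsilon> + 2) * M)"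
    and row: "- Re (w * cnj g * cis t) = 1 / (2 * c) * (q\<^sup>2 - p\<^sup>2 - c\<^sup>2 * (cmod g)\<^sup>2)"
  shows "\<bar>Re ((w - u) * cnj g * cis t)\<bar>
      \<le> \<epsilon> * (\<epsilon> + 2) * ((\<epsilon> + 2)\<^sup>2 + 1) * M / (2 * (1 - \<epsilon>)) * cmod g"
proof -
  let ?v = "u - of_real c * g * cis (- t)" and ?e = "Re ((w - u) * cnj g * cis t)"
  have cg: "0 < c * cmod g"
    using M \<epsilon> by (intro less_le_trans[OF _ c]) simp
  with g have c0: "c > 0" by (simp add: zero_less_mult_iff)
  have q2: "\<bar>q\<^sup>2 - (cmod ?v)\<^sup>2\<bar> \<le> \<epsilon> * (\<epsilon> + 2) ^ 3 * M\<^sup>2"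
    using abs_diff_squares_le[OF q, of "(\<epsilon> + 2) * M"] v
    by (simp add: algebra_simps power2_eq_square power3_eq_cube)
  have p2: "\<bar>p\<^sup>2 - (cmod u)\<^sup>2\<bar> \<le> \<epsilon> * (\<epsilon> + 2) * M\<^sup>2"
    using abs_diff_squares_le[OF p, of M] u by (simp add: algebra_simps power2_eq_square)
  have "?e = Re (w * cnj g * cis t) - Re (u * cnj g * cis t)"
    by (simp add: algebra_simps)
  moreover have "2 * c * Re (w * cnj g * cis t) = - (q\<^sup>2 - p\<^sup>2 - c\<^sup>2 * (cmod g)\<^sup>2)"
    using row c0 by (simp add: field_simps)
  moreover have "2 * c * Re (u * cnj g * cis t) = (cmod u)\<^sup>2 + c\<^sup>2 * (cmod g)\<^sup>2 - (cmod ?v)\<^sup>2"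
    by (simp only: cmod_minus_reference_square)
  ultimately have diff: "2 * c * ?e = (p\<^sup>2 - (cmod u)\<^sup>2) - (q\<^sup>2 - (cmod ?v)\<^sup>2)"
    by (simp only: right_diff_distrib)
  have e: "2 * c * \<bar>?e\<bar> \<le> \<epsilon> * (\<epsilon> + 2) * ((\<epsilon> + 2)\<^sup>2 + 1) * M\<^sup>2"
  proof -
    have "2 * c * \<bar>?e\<bar> = \<bar>2 * c * ?e\<bar>"
      using c0 by (simp add: abs_mult)
    also have "\<dots> \<le> \<epsilon> * (\<epsilon> + 2) * M\<^sup>2 + \<epsilon> * (\<epsilon> + 2) ^ 3 * M\<^sup>2"
      using p2 q2 diff by linarith
    also have "\<dots> = \<epsilon> * (\<epsilon> + 2) * ((\<epsilon> + 2)\<^sup>2 + 1) * M\<^sup>2"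
      by (simp add: algebra_simps power2_eq_square power3_eq_cube)
    finally show ?thesis .
  qed
  have "(2 * ((1 - \<epsilon>) * M)) * \<bar>?e\<bar> \<le> (2 * (c * cmod g)) * \<bar>?e\<bar>"
    using c by (intro mult_right_mono) auto
  also have "\<dots> = (2 * c * \<bar>?e\<bar>) * cmod g" by simp
  also have "\<dots> \<le> (\<epsilon> * (\<epsilon> + 2) * ((\<epsilon> + 2)\<^sup>2 + 1) * M\<^sup>2) * cmod g"
    using e by (rule mult_right_mono) simp
  finally have "M * (\<bar>?e\<bar> * (2 * (1 - \<epsilon>)))
      \<le> M * (\<epsilon> * (\<epsilon> + 2) * ((\<epsilon> + 2)\<^sup>2 + 1) * M * cmod g)"
    by (simp only: power2_eq_square mult_ac)
  then have "\<bar>?e\<bar> * (2 * (1 - \<epsilon>)) \<le> \<epsilon> * (\<epsilon> + 2) * ((\<epsilon> + 2)\<^sup>2 + 1) * M * cmod g"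
    using M by (simp only: mult_le_cancel_left_pos)
  then show ?thesis
    using \<epsilon> by (simp only: times_divide_eq_left) (subst pos_le_divide_eq, auto)
qed

text \<open>
  With \<open>y = \<epsilon> + 2\<close> and \<open>s = 5 / 14\<close> the claim becomes \<open>4 * y ^ 3 + 14 * y \<le> 10 * y\<^sup>2 + 60\<close>. Both
  sides agree at \<open>y = 3\<close>, so \<open>y - 3\<close> is a factor of the difference, and the other factor is
  positive.
\<close>
lemma stability_const_bound:
  assumes \<epsilon>: "0 < \<epsilon>" "\<epsilon> < 1" and s: "5 / 14 \<le> s"
  shows "\<epsilon> * (\<epsilon> + 2) * ((\<epsilon> + 2)\<^sup>2 + 1) / (1 - \<epsilon>) \<le> stability_const \<epsilon> * s"
proof -
  define y where "y = \<epsilon> + 2"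
  have y: "2 < y" "y < 3" using \<epsilon> by (auto simp: y_def)
  have "(y - 3) * (4 * y\<^sup>2 + 2 * y + 20) \<le> 0"
    using y by (intro mult_nonpos_nonneg) auto
  then have "y * (y\<^sup>2 + 1) \<le> 2 * ((y + 1) * y\<^sup>2 + 6) * (5 / 14)"
    by (simp add: algebra_simps power2_eq_square)
  also have "\<dots> \<le> 2 * ((y + 1) * y\<^sup>2 + 6) * s"
    using s y by (intro mult_left_mono) auto
  finally have "\<epsilon> / (1 - \<epsilon>) * (y * (y\<^sup>2 + 1)) \<le> \<epsilon> / (1 - \<epsilon>) * (2 * ((y + 1) * y\<^sup>2 + 6) * s)"
    using \<epsilon> by (intro mult_left_mono) auto
  moreover have "\<epsilon> + 3 = y + 1" by (simp add: y_def)
  ultimately show ?thesis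
    unfolding stability_const_def y_def[symmetric] \<open>\<epsilon> + 3 = y + 1\<close> by (simp add: mult_ac)
qed

section \<open>The reference phases\<close>

lemma wavenumber_pos:
  assumes "a > 0" "k \<in> wavenumbers a N"
  shows "k > 0"
proof -
  have "0 < 2 * pi / a * sqrt ((of_int l)\<^sup>2 + (of_int m)\<^sup>2)"
    if "1 \<le> max \<bar>l\<bar> \<bar>m\<bar>" for l m :: int
  proof -
    have "l \<noteq> 0 \<or> m \<noteq> 0" using that by auto
    then show ?thesis using assms(1) by (auto simp: sum_power2_gt_zero_iff)
  qed
  with assms show ?thesis by (auto simp: wavenumbers_def kstar_def)
qed

text \<open>
  Away from \<open>kstar a\<close> the offset \<open>pi / (2 * k)\<close> between the reference points makes their phases
  differ by a quarter turn, the best conditioned case.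
\<close>
lemma phase_difference_sin_ge:
  assumes "k > 0" "kstar_nondegenerate a k"
  shows "5 / 14 \<le> \<bar>sin (k * ref_alpha a k 1 - k * ref_alpha a k 2)\<bar>"
proof (cases "k = kstar a")
  case True
  with assms show ?thesis by (simp add: kstar_nondegenerate_def right_diff_distrib)
next
  case False
  then have "k * ref_alpha a k 1 - k * ref_alpha a k 2 = pi / 2"
    using assms(1) by (simp add: ref_alpha_def field_simps)
  then show ?thesis by (simp only: sin_pi_half)
qed

text \<open>
  The reference points move with the observation direction, which makes the phases, and with them
  the matrix of the system, independent of the direction.
\<close>
lemma ref_phase_circle:
  assumes "x \<in> unit_circle"
  shows "ref_phase a k j x = k * ref_alpha a k j"
  using assms by (simp add: ref_phase_def ref_point_def power2_norm_eq_inner[symmetric])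

lemma ref_far_field_eq:
  "ref_far_field a S k p j x
     = far_field a S k x - of_real (ref_scale k p) * gam k * cis (- ref_phase a k j x)"
  by (simp add: ref_far_field_def ref_phase_def cis_conv_exp mult_ac)

text \<open>
  Measurability of the recovered field is a consequence of its pointwise definition: the matrix
  is constant on the circle and invertible, so the solution is a fixed linear combination of the
  measurable right-hand sides.
\<close>
lemma solves_retrieval_system_measurable:
  assumes g: "gam k \<noteq> 0" and s: "sin (k * ref_alpha a k 1 - k * ref_alpha a k 2) \<noteq> 0"
    and p: "p \<in> borel_measurable circle_measure"
    and q: "\<And>j. j \<in> {1, 2} \<Longrightarrow> q j \<in> borel_measurable circle_measure"
    and sol: "\<And>x. x \<in> unit_circle \<Longrightarrow> solves_retrieval_system a k p q x (w x)"
  shows "w \<in> borel_measurable circle_measure"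
proof -
  define t where "t j = k * ref_alpha a k j" for j
  define f where "f j = retrieval_rhs k p (q j)" for j
  define d where "d = \<i> * cis (t 1) * cis (t 2) * of_real (sin (t 1 - t 2)) * cnj (gam k)"
  have f_meas: "f j \<in> borel_measurable circle_measure" if "j \<in> {1, 2}" for j
    using p q[OF that] unfolding f_def retrieval_rhs_def[abs_def] by measurable
  have "d \<noteq> 0" using g s by (simp add: d_def t_def)
  have "w x = (of_real (f 2 x) * cis (t 2) - of_real (f 1 x) * cis (t 1)) / d"
    if x: "x \<in> unit_circle" for x
  proof -
    have "Re (w x * cnj (gam k) * cis (t j)) = - f j x" if "j \<in> {1, 2}" for j
      using sol[OF x] that ref_phase_circle[OF x]
      unfolding solves_retrieval_system_def retrieval_row_eq f_def t_def
      by (metis minus_minus)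
    then have "w x * d = of_real (f 2 x) * cis (t 2) - of_real (f 1 x) * cis (t 1)"
      using two_projections_eq[of "w x * cnj (gam k)" "t 1" "t 2"] by (simp add: d_def mult_ac)
    with \<open>d \<noteq> 0\<close> show ?thesis by (simp add: field_simps)
  qed
  moreover have "(\<lambda>x. (of_real (f 2 x) * cis (t 2) - of_real (f 1 x) * cis (t 1)) / d)
      \<in> borel_measurable circle_measure"
    using f_meas[of 1] f_meas[of 2] by measurable
  ultimately show ?thesis
    by (subst measurable_cong) auto
qed

section \<open>Stability of the phase retrieval\<close>

theorem theorem3p2:
  fixes a k \<epsilon> :: real
    and N :: nat
    and S u\<epsilon> :: "real ^ 2 \<Rightarrow> complex"
    and p :: "real ^ 2 \<Rightarrow> real"
    and q :: "nat \<Rightarrow> real ^ 2 \<Rightarrow> real"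
  assumes "a > 0"
    and "S \<in> L2 lebesgue"
    and "compact (ess_support S)" and "ess_support S \<subseteq> square a"
    and "N \<ge> 1" and "k \<in> wavenumbers a N"
    and "kstar_nondegenerate a k"
    and "\<exists>x\<in>unit_circle. far_field a S k x \<noteq> 0"
    and "0 < \<epsilon>" and "\<epsilon> < 1"
    and "p \<in> Linf circle_measure" and "AE x in circle_measure. 0 \<le> p x"
    and "\<And>j. j \<in> {1, 2} \<Longrightarrow> q j \<in> Linf circle_measure"
    and "\<And>j. j \<in> {1, 2} \<Longrightarrow> AE x in circle_measure. 0 \<le> q j x"
    and "Linf_norm circle_measure (\<lambda>x. p x - cmod (far_field a S k x))
           \<le> ereal \<epsilon> * Linf_norm circle_measure (far_field a S k)"
    and "\<And>j. j \<in> {1, 2} \<Longrightarrow>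
           Linf_norm circle_measure (\<lambda>x. q j x - cmod (ref_far_field a S k p j x))
             \<le> ereal \<epsilon> * Linf_norm circle_measure (ref_far_field a S k p j)"
    and "\<And>x. x \<in> unit_circle \<Longrightarrow> solves_retrieval_system a k p q x (u\<epsilon> x)"
  shows "Linf_norm circle_measure (\<lambda>x. u\<epsilon> x - far_field a S k x)
           \<le> ereal (stability_const \<epsilon>) * Linf_norm circle_measure (far_field a S k)"
proof -
  let ?C = circle_measure and ?u = "far_field a S k"
  let ?v = "ref_far_field a S k p"
  define g where "g = gam k"
  define c where "c = ref_scale k p"
  define t where "t j = k * ref_alpha a k j" for j
  define s where "s = \<bar>sin (t 1 - t 2)\<bar>"
  have k: "k > 0" using assms(1,6) by (rule wavenumber_pos)
  have g0: "g \<noteq> 0" using k by (simp add: g_def gam_def)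
  have s: "5 / 14 \<le> s"
    using phase_difference_sin_ge[OF k assms(7)] by (simp add: s_def t_def)
  have u_cont: "continuous_on UNIV ?u" using assms(2) by (rule continuous_on_far_field)
  have u_meas [measurable]: "?u \<in> borel_measurable ?C"
    using u_cont by (rule continuous_imp_measurable_circle)
  have p_meas [measurable]: "p \<in> borel_measurable ?C" using assms(11) by (simp add: Linf_def)
  have q_meas [measurable]: "q j \<in> borel_measurable ?C" if "j \<in> {1, 2}" for j
    using assms(13)[OF that] by (simp add: Linf_def)
  have v_meas [measurable]: "?v j \<in> borel_measurable ?C" for j
    unfolding ref_far_field_def[abs_def] ref_point_def
    by (intro continuous_imp_measurable_circle continuous_intros u_cont)
  have w_meas [measurable]: "u\<epsilon> \<in> borel_measurable ?C"
    using s g0 p_meas q_meas assms(17)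
    by (intro solves_retrieval_system_measurable[where a = a and k = k and p = p and q = q])
      (auto simp: s_def t_def g_def)
  obtain M where M: "M > 0" "Linf_norm ?C ?u = ereal M"
    using Linf_norm_circle_continuous_pos[OF u_cont] assms(8) by blast
  obtain P where P: "0 \<le> P" "Linf_norm ?C p = ereal P"
    using Linf_norm_circle_nonneg[of p] assms(11)
    by (cases "Linf_norm ?C p") (auto simp: Linf_def)
  have cg: "c * cmod g = P"
    using g0 P by (simp add: c_def g_def ref_scale_def)
  have u_le: "AE x in ?C. cmod (?u x) \<le> M"
    using Linf_norm_le_iff[OF u_meas, of M] M by simp
  have p_le: "AE x in ?C. \<bar>p x\<bar> \<le> P"
    using Linf_norm_le_iff[OF p_meas, of P] P by simp
  have p_err: "AE x in ?C. \<bar>p x - cmod (?u x)\<bar> \<le> \<epsilon> * M"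
    using assms(15) M Linf_norm_le_iff[of "\<lambda>x. p x - cmod (?u x)" ?C "\<epsilon> * M"] by simp
  \<comment> \<open>The measured norm \<open>P\<close> differs from the true norm \<open>M\<close> by at most \<open>\<epsilon> * M\<close>. The lower
    bound keeps the division by the amplitude harmless, the upper one controls \<open>?v\<close>.\<close>
  have "AE x in ?C. cmod (?u x) \<le> P + \<epsilon> * M"
    using p_le p_err by eventually_elim auto
  then have "M \<le> P + \<epsilon> * M"
    using Linf_norm_le_iff[OF u_meas, of "P + \<epsilon> * M"] M by simp
  then have c_ge: "(1 - \<epsilon>) * M \<le> c * cmod g" by (simp add: cg algebra_simps)
  have "AE x in ?C. norm (p x) \<le> (\<epsilon> + 1) * M"
    using u_le p_err
  proof eventually_elim
    case (elim x)
    then show ?case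
      using norm_ge_zero[of "?u x"] unfolding real_norm_def distrib_right mult_1 by linarith
  qed
  then have P_le: "P \<le> (\<epsilon> + 1) * M"
    using Linf_norm_le_iff[OF p_meas, of "(\<epsilon> + 1) * M"] P by simp
  have v_le: "AE x in ?C. cmod (?v j x) \<le> (\<epsilon> + 2) * M" for j
    using u_le
  proof eventually_elim
    case (elim x)
    have "cmod (?v j x) \<le> cmod (?u x) + P"
      unfolding ref_far_field_eq using P(1)
      by (intro order_trans[OF norm_triangle_ineq4]) (simp add: norm_mult flip: cg c_def g_def)
    with elim P_le show ?case by (simp add: algebra_simps)
  qed
  have q_err: "AE x in ?C. \<bar>q j x - cmod (?v j x)\<bar> \<le> \<epsilon> * ((\<epsilon> + 2) * M)" if j: "j \<in> {1, 2}" for j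
  proof -
    have "Linf_norm ?C (?v j) \<le> ereal ((\<epsilon> + 2) * M)"
      using v_le by (simp add: Linf_norm_le_iff)
    then have "ereal \<epsilon> * Linf_norm ?C (?v j) \<le> ereal \<epsilon> * ereal ((\<epsilon> + 2) * M)"
      using assms(9) by (intro ereal_mult_left_mono) auto
    with assms(16)[OF j] have
      "Linf_norm ?C (\<lambda>x. q j x - cmod (?v j x)) \<le> ereal (\<epsilon> * ((\<epsilon> + 2) * M))"
      by (auto dest: order_trans)
    moreover have "(\<lambda>x. q j x - cmod (?v j x)) \<in> borel_measurable ?C"
      using q_meas[OF j] by measurable
    ultimately show ?thesis by (simp add: Linf_norm_le_iff)
  qed
  have row_err: "AE x in ?C. \<bar>Re ((u\<epsilon> x - ?u x) * cnj g * cis (t j))\<bar>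
      \<le> \<epsilon> * (\<epsilon> + 2) * ((\<epsilon> + 2)\<^sup>2 + 1) * M / (2 * (1 - \<epsilon>)) * cmod g" if j: "j \<in> {1, 2}" for j
    using AE_space u_le p_err v_le[of j] q_err[OF j]
  proof eventually_elim
    case (elim x)
    then have x: "x \<in> unit_circle" by simp
    have "- Re (u\<epsilon> x * cnj g * cis (t j))
        = 1 / (2 * c) * ((q j x)\<^sup>2 - (p x)\<^sup>2 - c\<^sup>2 * (cmod g)\<^sup>2)"
      using assms(17)[OF x] j ref_phase_circle[OF x, of a k j]
      unfolding solves_retrieval_system_def retrieval_row_eq retrieval_rhs_def g_def c_def t_def
      by metis
    with elim show ?case
      using M(1) assms(9,10) g0 c_ge ref_phase_circle[OF x, of a k j]
      by (intro retrieval_row_error[where p = "p x" and q = "q j x" and c = c])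
        (auto simp: ref_far_field_eq g_def c_def t_def)
  qed
  note row1 = row_err[OF insertI1] and row2 = row_err[OF insertI2[OF singletonI]]
  have "AE x in ?C. norm (u\<epsilon> x - ?u x) \<le> stability_const \<epsilon> * M"
    using row1 row2
  proof eventually_elim
    case (elim x)
    let ?B = "\<epsilon> * (\<epsilon> + 2) * ((\<epsilon> + 2)\<^sup>2 + 1)"
    have halves: "b / (2 * d) * y + b / (2 * d) * y = b / d * y" for b d y :: real
      by (simp flip: mult_2)
    have "cmod ((u\<epsilon> x - ?u x) * cnj g) * s
        \<le> \<bar>Re ((u\<epsilon> x - ?u x) * cnj g * cis (t 1))\<bar> + \<bar>Re ((u\<epsilon> x - ?u x) * cnj g * cis (t 2))\<bar>"
      unfolding s_def by (rule cmod_le_two_projections)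
    also have "\<dots> \<le> ?B * M / (2 * (1 - \<epsilon>)) * cmod g + ?B * M / (2 * (1 - \<epsilon>)) * cmod g"
      by (rule add_mono[OF elim])
    also have "\<dots> = (?B / (1 - \<epsilon>)) * M * cmod g"
      by (simp only: halves) (simp only: times_divide_eq_left)
    also have "\<dots> \<le> (stability_const \<epsilon> * s) * M * cmod g"
      using M(1) stability_const_bound[OF assms(9,10) s]
      by (intro mult_right_mono) auto
    finally have "cmod (u\<epsilon> x - ?u x) * (s * cmod g) \<le> stability_const \<epsilon> * M * (s * cmod g)"
      by (simp add: norm_mult mult_ac)
    moreover have "s * cmod g > 0" using s g0 by simp
    ultimately show ?case by (simp only: mult_le_cancel_right_pos)
  qed
  then have "Linf_norm ?C (\<lambda>x. u\<epsilon> x - ?u x) \<le> ereal (stability_const \<epsilon> * M)"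
    by (subst Linf_norm_le_iff) auto
  then show ?thesis by (simp add: M(2))
qed

end
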